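(* Let $\mathcal{H}$ be a separable infinite-dimensional complex Hilbert space and let $T\in\mathcal{B}(\mathcal{H})$ have, with respect to some orthonormal basis, a block tridiagonal matrix $$\begin{pmatrix} C_1 & A_1 & 0 & \\ B_1 & C_2 & A_2 & \\ 0 & B_2 & C_3 & \ddots\\ & & \ddots & \ddots\end{pmatrix}$$ whose sequence of diagonal block sizes $(n_k)_{k\ge1}$ is non-decreasing. Then this matrix is unitarily equivalent to a block tridiagonal matrix with the same block sizes, with diagonal blocks $\tilde C_k$, superdiagonal blocks $\tilde A_k$ and subdiagonal blocks $\tilde B_k$, in which for every $k$ the block $\tilde A_k$ has the form $(A_k'\mid 0)$ with $A_k'$ a positive square matrix. Alternatively, it is also unitarily equivalent to a block tridiagonal matrix with the same block sizes in which for every $k$ the subdiagonal block $\tilde B_k$ has the form $\begin{pmatrix} B_k'\\ 0\end{pmatrix}$ with $B_k'$ a positive square matrix.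
   Context: In a block tridiagonal matrix with diagonal block sizes $(n_k)$ (positive integers), $C_k$ is $n_k\times n_k$, $A_k$ is $n_k\times n_{k+1}$, $B_k$ is $n_{k+1}\times n_k$, and all entries outside these blocks are zero. The square matrices $A_k'$ and $B_k'$ are $n_k\times n_k$. "Positive" means positive semidefinite. Two matrices are unitarily equivalent if they represent the same operator with respect to two orthonormal bases, equivalently (up to unitary identification) if they are conjugate by a unitary operator. *)

theory Defs
  imports "HOL-Analysis.Elementary_Topology" "Jordan_Normal_Form.Matrix"
begin

text \<open>
  Complex Hilbert spaces, as a type class on top of the real class \<open>banach\<close>; the inner product is
  linear in its first and conjugate-linear in its second argument. Positive definiteness is part of
  \<open>cinner_self\<close>, since \<open>norm\<close> is a norm.
\<close>

class chilbert_space = banach +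
  fixes scaleC :: "complex \<Rightarrow> 'a \<Rightarrow> 'a" (infixr "*\<^sub>C" 75)
    and cinner :: "'a \<Rightarrow> 'a \<Rightarrow> complex"
  assumes scaleC_add_right: "a *\<^sub>C (x + y) = a *\<^sub>C x + a *\<^sub>C y"
    and scaleC_add_left: "(a + b) *\<^sub>C x = a *\<^sub>C x + b *\<^sub>C x"
    and scaleC_scaleC: "a *\<^sub>C b *\<^sub>C x = (a * b) *\<^sub>C x"
    and scaleC_of_real: "complex_of_real r *\<^sub>C x = r *\<^sub>R x"
    and cinner_add_left: "cinner (x + y) z = cinner x z + cinner y z"
    and cinner_scaleC_left: "cinner (a *\<^sub>C x) y = a * cinner x y"
    and cinner_commute: "cinner y x = cnj (cinner x y)"
    and cinner_self: "cinner x x = complex_of_real ((norm x)\<^sup>2)"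

interpretation complex_vector: vector_space "scaleC :: complex \<Rightarrow> 'a \<Rightarrow> 'a::chilbert_space"
proof
  fix a b :: complex and x y :: 'a
  show "a *\<^sub>C (x + y) = a *\<^sub>C x + a *\<^sub>C y" by (rule scaleC_add_right)
  show "(a + b) *\<^sub>C x = a *\<^sub>C x + b *\<^sub>C x" by (rule scaleC_add_left)
  show "a *\<^sub>C b *\<^sub>C x = (a * b) *\<^sub>C x" by (rule scaleC_scaleC)
  show "1 *\<^sub>C x = x" using scaleC_of_real[of 1 x] by simp
qed

definition bounded_clinear :: "('a::chilbert_space \<Rightarrow> 'a) \<Rightarrow> bool" where
  "bounded_clinear T \<longleftrightarrow> bounded_linear T \<and> (\<forall>c x. T (c *\<^sub>C x) = c *\<^sub>C T x)"

text \<open>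
  Orthonormal bases are indexed by all of \<open>nat\<close>. A space possessing such a basis is separable and
  infinite-dimensional, and conversely.
\<close>

definition orthonormal_basis :: "(nat \<Rightarrow> 'a::chilbert_space) \<Rightarrow> bool" where
  "orthonormal_basis e \<longleftrightarrow>
     (\<forall>i j. cinner (e i) (e j) = (if i = j then 1 else 0)) \<and>
     closure (complex_vector.span (range e)) = UNIV"

text \<open>
  The infinite matrix of \<open>T\<close> with respect to \<open>e\<close>: column \<open>j\<close> holds the coordinates of \<open>T (e j)\<close>.
  Two such matrices are unitarily equivalent if they are \<open>matrix_of T e\<close> and \<open>matrix_of T f\<close> for
  the same operator \<open>T\<close> and orthonormal bases \<open>e\<close> and \<open>f\<close>.
\<close>

definition matrix_of :: "('a::chilbert_space \<Rightarrow> 'a) \<Rightarrow> (nat \<Rightarrow> 'a) \<Rightarrow> nat \<Rightarrow> nat \<Rightarrow> complex" where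
  "matrix_of T e i j = cinner (T (e j)) (e i)"

text \<open>
  Block indices and matrix indices start at 0: the diagonal block number \<open>k\<close> has size \<open>n k\<close> and
  starts at row and column \<open>n 0 + ... + n (k - 1)\<close>.
\<close>

definition block_start :: "(nat \<Rightarrow> nat) \<Rightarrow> nat \<Rightarrow> nat" where
  "block_start n k = (\<Sum>i<k. n i)"

definition block :: "(nat \<Rightarrow> nat) \<Rightarrow> (nat \<Rightarrow> nat \<Rightarrow> complex) \<Rightarrow> nat \<Rightarrow> nat \<Rightarrow> complex mat" where
  "block n M k l = mat (n k) (n l) (\<lambda>(i, j). M (block_start n k + i) (block_start n l + j))"

text \<open>
  Since all sizes are positive, the blocks cover the whole matrix.
\<close>

definition block_tridiagonal :: "(nat \<Rightarrow> nat) \<Rightarrow> (nat \<Rightarrow> nat \<Rightarrow> complex) \<Rightarrow> bool" where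
  "block_tridiagonal n M \<longleftrightarrow>
     (\<forall>k. 0 < n k) \<and>
     (\<forall>k l. k + 1 < l \<or> l + 1 < k \<longrightarrow> block n M k l = 0\<^sub>m (n k) (n l))"

text \<open>
  In the order on \<open>complex\<close>, \<open>0 \<le> z\<close> means that \<open>z\<close> is real and non-negative; over the complex
  numbers the condition below therefore forces \<open>A\<close> to be Hermitian.
\<close>

definition positive_mat :: "complex mat \<Rightarrow> bool" where
  "positive_mat A \<longleftrightarrow> square_mat A \<and> (\<forall>v \<in> carrier_vec (dim_col A). 0 \<le> (A *\<^sub>v v) \<bullet>c v)"

definition append_cols :: "'a::zero mat \<Rightarrow> 'a mat \<Rightarrow> 'a mat" (infixr "@\<^sub>c" 65) where
  "A @\<^sub>c B = (A\<^sup>T @\<^sub>r B\<^sup>T)\<^sup>T"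

end

theory Submission
  imports "HOL-Analysis.Function_Topology" "HOL-Analysis.Topology_Euclidean_Space"
    Defs "Jordan_Normal_Form.Schur_Decomposition"
begin

text \<open>
  The new basis is obtained by rotating every block of the old one by a unitary matrix \<open>W k\<close>, which
  keeps the blocks outside the three diagonals zero. The \<open>W k\<close> are chosen recursively: given \<open>W k\<close>,
  the matrix \<open>W (k + 1)\<close> comes from a polar decomposition of the \<open>n k \<times> n (k + 1)\<close> matrix
  \<open>B = (W k)\<^sup>* A k\<close>, i.e. \<open>B W (k + 1) = (P | 0)\<close> with \<open>P\<close> positive. Such a unitary is one that
  maximizes the real part of the trace of the left square part of \<open>B W\<close>; it exists by compactness of
  the unitary group. The statement about subdiagonal blocks follows by taking adjoints.
\<close>

section \<open>Unitary matrices\<close>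

lemma mat_adjoint_index [simp]:
  "i < dim_col A \<Longrightarrow> j < dim_row A \<Longrightarrow> mat_adjoint A $$ (i, j) = conjugate (A $$ (j, i))"
  by (simp add: mat_adjoint_def mat_of_rows_index)

lemma mat_adjoint_dim [simp]:
  "dim_row (mat_adjoint A) = dim_col A" "dim_col (mat_adjoint A) = dim_row A"
  by (simp_all add: mat_adjoint_def)

lemma mat_adjoint_carrier [simp]: "A \<in> carrier_mat m n \<Longrightarrow> mat_adjoint A \<in> carrier_mat n m"
  by (auto intro: carrier_matI)

lemma mat_adjoint_mat_adjoint [simp]: "mat_adjoint (mat_adjoint A) = A"
  by (rule eq_matI) auto

lemma mult_mat_index:
  assumes "A \<in> carrier_mat m n" "B \<in> carrier_mat n p" "i < m" "j < p"
  shows "(A * B) $$ (i, j) = (\<Sum>k<n. A $$ (i, k) * B $$ (k, j))"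
  using assms by (auto simp: scalar_prod_def lessThan_atLeast0 intro!: sum.cong)

lemma mat_adjoint_mult:
  fixes A :: "complex mat"
  assumes "A \<in> carrier_mat m n" "B \<in> carrier_mat n p"
  shows "mat_adjoint (A * B) = mat_adjoint B * mat_adjoint A"
proof (rule eq_matI)
  fix i j assume "i < dim_row (mat_adjoint B * mat_adjoint A)" "j < dim_col (mat_adjoint B * mat_adjoint A)"
  then have ij: "i < p" "j < m" using assms by auto
  have "mat_adjoint (A * B) $$ (i, j) = cnj ((A * B) $$ (j, i))"
    using ij assms by simp
  also have "\<dots> = (\<Sum>k<n. cnj (B $$ (k, i)) * cnj (A $$ (j, k)))"
    using ij assms by (subst mult_mat_index[OF assms]) (auto simp: mult.commute)
  also have "\<dots> = (mat_adjoint B * mat_adjoint A) $$ (i, j)"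
    using ij assms by (subst mult_mat_index[of _ p n _ m]) auto
  finally show "mat_adjoint (A * B) $$ (i, j) = (mat_adjoint B * mat_adjoint A) $$ (i, j)" .
qed (use assms in auto)

definition unitary_mats :: "nat \<Rightarrow> complex mat set" where
  "unitary_mats n = {U \<in> carrier_mat n n. mat_adjoint U * U = 1\<^sub>m n}"

lemma unitary_mats_carrier: "U \<in> unitary_mats n \<Longrightarrow> U \<in> carrier_mat n n"
  by (simp add: unitary_mats_def)

text \<open>Orthonormality of the columns, entry by entry. In this form unitarity is a family of
  closed polynomial conditions and can be checked by hand for rank-one perturbations of the
  identity.\<close>

lemma unitary_mats_iff:
  "U \<in> unitary_mats n \<longleftrightarrow> U \<in> carrier_mat n n \<and>
    (\<forall>i<n. \<forall>j<n. (\<Sum>k<n. cnj (U $$ (k, i)) * U $$ (k, j)) = (if i = j then 1 else 0))"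
proof (cases "U \<in> carrier_mat n n")
  case True
  then have *: "(mat_adjoint U * U) $$ (i, j) = (\<Sum>k<n. cnj (U $$ (k, i)) * U $$ (k, j))"
    if "i < n" "j < n" for i j
    using that by (subst mult_mat_index[of _ n n _ n]) auto
  have "mat_adjoint U * U = 1\<^sub>m n \<longleftrightarrow>
      (\<forall>i<n. \<forall>j<n. (mat_adjoint U * U) $$ (i, j) = (if i = j then 1 else 0))"
    (is "?l \<longleftrightarrow> ?r")
  proof
    assume ?r then show ?l using True by (intro eq_matI) auto
  qed auto
  then show ?thesis using True * by (auto simp: unitary_mats_def)
qed (simp add: unitary_mats_def)

text \<open>A left inverse of a square matrix is a right inverse. The rows are therefore orthonormal
  too, which is what recovers the old basis vectors from the rotated ones.\<close>

lemma unitary_mats_mult_adjoint: "U \<in> unitary_mats n \<Longrightarrow> U * mat_adjoint U = 1\<^sub>m n"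
  unfolding unitary_mats_def using mat_mult_left_right_inverse[of "mat_adjoint U" n U] by auto

lemma one_in_unitary_mats: "1\<^sub>m n \<in> unitary_mats n"
  by (auto simp: unitary_mats_iff if_distrib cong: if_cong)

lemma mult_in_unitary_mats:
  assumes "U \<in> unitary_mats n" "V \<in> unitary_mats n"
  shows "U * V \<in> unitary_mats n"
proof -
  have c: "U \<in> carrier_mat n n" "V \<in> carrier_mat n n"
    using assms by (auto simp: unitary_mats_def)
  have "mat_adjoint (U * V) * (U * V) = mat_adjoint V * (mat_adjoint U * U * V)"
    using c by (simp add: mat_adjoint_mult[OF c] assoc_mult_mat[of _ n n _ n _ n])
  also have "\<dots> = 1\<^sub>m n" using assms c by (simp add: unitary_mats_def)
  finally show ?thesis using c by (simp add: unitary_mats_def)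
qed

section \<open>Maximizing the trace over the unitary group\<close>

lemma compact_unitary_functions:
  "compact {u :: nat \<times> nat \<Rightarrow> complex. (\<forall>p. p \<notin> {..<n} \<times> {..<n} \<longrightarrow> u p = 0) \<and>
     (\<forall>i<n. \<forall>j<n. (\<Sum>k<n. cnj (u (k, i)) * u (k, j)) = (if i = j then 1 else 0))}"
  (is "compact ?S")
proof -
  \<comment> \<open>Matrices are encoded as functions on index pairs, extended by zero, so that the
    product topology applies: a product of closed unit discs is compact by Tychonoff, and the
    unitary functions form a closed subset of it.\<close>
  let ?C = "PiE UNIV (\<lambda>_. cball 0 1) :: (nat \<times> nat \<Rightarrow> complex) set"
  have C: "compact ?C"
    using compactin_PiE[of "\<lambda>_. euclidean" UNIV "\<lambda>_::nat \<times> nat. cball (0::complex) 1"]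
    by (simp add: euclidean_product_topology compactin_euclidean_iff)
  have cont [continuous_intros]: "continuous_on UNIV (\<lambda>u :: nat \<times> nat \<Rightarrow> complex. u p)" for p
    by (rule continuous_on_product_coordinates)
  have "closed ?S"
    by (intro closed_Collect_conj closed_Collect_all closed_Collect_imp open_Collect_const
        closed_Collect_eq continuous_intros)
  moreover have "u \<in> ?C" if u: "u \<in> ?S" for u
  proof -
    have "norm (u p) \<le> 1" for p
    proof (cases "p \<in> {..<n} \<times> {..<n}")
      case True
      then obtain k i where p: "p = (k, i)" "k < n" "i < n" by auto
      \<comment> \<open>Every column has norm one, so no entry exceeds one in modulus.\<close>
      then have "(\<Sum>k<n. cnj (u (k, i)) * u (k, i)) = 1" using u by auto
      then have "complex_of_real (\<Sum>k<n. (norm (u (k, i)))\<^sup>2) = 1"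
        by (simp only: of_real_sum complex_norm_square mult.commute)
      then have "(\<Sum>k<n. (norm (u (k, i)))\<^sup>2) = 1" using of_real_eq_1_iff by blast
      moreover have "(norm (u (k, i)))\<^sup>2 \<le> (\<Sum>k<n. (norm (u (k, i)))\<^sup>2)"
        using p by (intro member_le_sum) auto
      ultimately have "(norm (u p))\<^sup>2 \<le> 1" using p by simp
      then show ?thesis by (simp add: power_le_one_iff abs_square_le_1)
    next
      case False
      then have "u p = 0" using u by blast
      then show ?thesis by simp
    qed
    then show ?thesis by auto
  qed
  ultimately have "compact (?C \<inter> ?S)" "?C \<inter> ?S = ?S"
    using compact_Int_closed[OF C] by blast+
  then show ?thesis by (simp only:)
qed

lemma exists_unitary_maximizing_trace:
  assumes B: "B \<in> carrier_mat m n" and "m \<le> n"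
  obtains U where "U \<in> unitary_mats n"
    "\<And>V. V \<in> unitary_mats n \<Longrightarrow> (\<Sum>i<m. Re ((B * V) $$ (i, i))) \<le> (\<Sum>i<m. Re ((B * U) $$ (i, i)))"
proof -
  let ?S = "{u :: nat \<times> nat \<Rightarrow> complex. (\<forall>p. p \<notin> {..<n} \<times> {..<n} \<longrightarrow> u p = 0) \<and>
     (\<forall>i<n. \<forall>j<n. (\<Sum>k<n. cnj (u (k, i)) * u (k, j)) = (if i = j then 1 else 0))}"
  \<comment> \<open>\<open>F\<close> is the function to maximize, read on encoded matrices;
    \<open>h\<close> is the encoding, inverse to \<open>mat n n\<close> on functions supported in
    the square.\<close>
  define F where "F u = (\<Sum>i<m. Re (\<Sum>k<n. B $$ (i, k) * u (k, i)))" for u :: "nat \<times> nat \<Rightarrow> complex"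
  define h where "h V p = (if p \<in> {..<n} \<times> {..<n} then V $$ p else 0)" for V :: "complex mat" and p
  have h: "h V \<in> ?S" "F (h V) = (\<Sum>i<m. Re ((B * V) $$ (i, i)))" if "V \<in> unitary_mats n" for V
  proof -
    show "h V \<in> ?S" using that by (auto simp: unitary_mats_iff h_def)
    show "F (h V) = (\<Sum>i<m. Re ((B * V) $$ (i, i)))"
      unfolding F_def using \<open>m \<le> n\<close>
      by (intro sum.cong refl, subst mult_mat_index[OF B unitary_mats_carrier[OF that]])
        (auto simp: h_def intro!: sum.cong)
  qed
  have cont [continuous_intros]: "continuous_on A (\<lambda>u :: nat \<times> nat \<Rightarrow> complex. u p)" for p A
    by (rule continuous_on_product_coordinates[THEN continuous_on_subset]) simp
  have contF: "continuous_on ?S F" unfolding F_def by (intro continuous_intros)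
  have ne: "?S \<noteq> {}"
    using h(1)[OF one_in_unitary_mats] unfolding ex_in_conv[symmetric]
    by (rule exI[of _ "h (1\<^sub>m n)"])
  obtain u where u: "u \<in> ?S" "\<forall>v\<in>?S. F v \<le> F u"
    using continuous_attains_sup[OF compact_unitary_functions ne contF] by (elim bexE)
  define U where "U = mat n n u"
  have U: "U \<in> unitary_mats n" using u(1) by (auto simp: unitary_mats_iff U_def)
  have "h U = u" using u(1) by (auto simp: h_def U_def fun_eq_iff)
  show ?thesis
  proof (rule that[OF U])
    fix V assume V: "V \<in> unitary_mats n"
    have "F (h V) \<le> F (h U)" using u(2) h(1)[OF V] unfolding \<open>h U = u\<close> by (rule bspec)
    then show "(\<Sum>i<m. Re ((B * V) $$ (i, i))) \<le> (\<Sum>i<m. Re ((B * U) $$ (i, i)))"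
      by (simp only: h(2)[OF V] h(2)[OF U])
  qed
qed

text \<open>
  The variation is along the unitaries \<open>1 - c v v\<^sup>*\<close>. Writing \<open>c = (1 - w) / \<bar>v\<bar>\<^sup>2\<close> with \<open>\<bar>w\<bar> = 1\<close>,
  maximality gives \<open>Re ((1 - w) z) \<ge> 0\<close> for the value \<open>z\<close> of the form, and a suitable \<open>w\<close> turns this
  into \<open>Re z \<ge> \<bar>z\<bar>\<close>.
\<close>

lemma nonneg_form_if_trace_maximal:
  fixes v :: "nat \<Rightarrow> complex"
  assumes X: "X \<in> carrier_mat m n" and "m \<le> n"
    and max: "\<And>V. V \<in> unitary_mats n \<Longrightarrow>
      (\<Sum>i<m. Re ((X * V) $$ (i, i))) \<le> (\<Sum>i<m. Re (X $$ (i, i)))"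
  shows "0 \<le> (\<Sum>i<m. \<Sum>k<n. X $$ (i, k) * v k * cnj (v i))"
proof -
  define z where "z = (\<Sum>i<m. \<Sum>k<n. X $$ (i, k) * v k * cnj (v i))"
  define N where "N = (\<Sum>k<n. (norm (v k))\<^sup>2)"
  have N: "(\<Sum>k<n. cnj (v k) * v k) = of_real N"
    by (simp only: N_def of_real_sum complex_norm_square mult.commute)
  \<comment> \<open>The condition on \<open>c\<close> is unitarity of
    \<open>1 - c v v\<^sup>*\<close>: its adjoint times itself is the identity minus
    \<open>c + cnj c - c * cnj c * N\<close> times \<open>v v\<^sup>*\<close>.\<close>
  have vary: "0 \<le> Re (c * z)" if c: "c + cnj c = c * cnj c * of_real N" for c
  proof -
    define V where "V = mat n n (\<lambda>(i, j). (if i = j then 1 else 0) - c * v i * cnj (v j))"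
    have "(\<Sum>k<n. cnj (V $$ (k, i)) * V $$ (k, j)) = (if i = j then 1 else 0)"
      if ij: "i < n" "j < n" for i j
    proof -
      have "(\<Sum>k<n. cnj (V $$ (k, i)) * V $$ (k, j)) =
          (\<Sum>k<n. (if k = i then (if i = j then 1 else 0) else 0)
            - (if k = i then c * v k * cnj (v j) else 0)
            - (if k = j then cnj c * cnj (v k) * v i else 0)
            + c * cnj c * v i * cnj (v j) * (cnj (v k) * v k))"
        using ij by (intro sum.cong refl) (auto simp: V_def algebra_simps)
      also have "\<dots> = (if i = j then 1 else 0) - c * v i * cnj (v j) - cnj c * cnj (v j) * v i
          + c * cnj c * v i * cnj (v j) * of_real N"
        using ij by (simp add: sum.distrib sum_subtractf sum_distrib_left[symmetric] N)
      also have "\<dots> = (if i = j then 1 else 0) - v i * cnj (v j) * (c + cnj c - c * cnj c * of_real N)"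
        by (simp add: algebra_simps)
      finally show ?thesis using c by simp
    qed
    then have V: "V \<in> unitary_mats n" by (simp add: unitary_mats_iff V_def)
    \<comment> \<open>Summed over \<open>i < m\<close>, the rank-one term lowers the trace of the
      left square part by exactly \<open>c * z\<close>, so maximality at the identity forces
      \<open>Re (c * z)\<close> to be nonnegative.\<close>
    have "(X * V) $$ (i, i) = X $$ (i, i) - c * (\<Sum>k<n. X $$ (i, k) * v k * cnj (v i))"
      if i: "i < m" for i
    proof -
      have "(X * V) $$ (i, i) = (\<Sum>k<n. X $$ (i, k) * V $$ (k, i))"
        using i \<open>m \<le> n\<close> by (subst mult_mat_index[OF X unitary_mats_carrier[OF V]]) auto
      also have "\<dots> = (\<Sum>k<n. (if k = i then X $$ (i, k) else 0)
          - c * (X $$ (i, k) * v k * cnj (v i)))"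
        using i \<open>m \<le> n\<close> by (intro sum.cong refl) (auto simp: V_def algebra_simps)
      also have "\<dots> = X $$ (i, i) - c * (\<Sum>k<n. X $$ (i, k) * v k * cnj (v i))"
        using i \<open>m \<le> n\<close> by (simp add: sum_subtractf sum_distrib_left[symmetric])
      finally show ?thesis .
    qed
    then have "(\<Sum>i<m. (X * V) $$ (i, i)) = (\<Sum>i<m. X $$ (i, i)) - c * z"
      by (simp add: z_def sum_subtractf sum_distrib_left[symmetric])
    then have "(\<Sum>i<m. Re ((X * V) $$ (i, i))) = (\<Sum>i<m. Re (X $$ (i, i))) - Re (c * z)"
      by (metis Re_sum minus_complex.sel(1))
    then show ?thesis using max[OF V] by linarith
  qed
  show ?thesis
  proof (cases "z = 0 \<or> N = 0")
    case True
    \<comment> \<open>If \<open>N = 0\<close>, then \<open>v\<close> vanishes below \<open>n\<close>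
      and so does the form; otherwise division by \<open>N\<close> is possible.\<close>
    moreover have "z = 0" if "N = 0"
    proof -
      have "v k = 0" if "k < n" for k
        using \<open>N = 0\<close> that by (auto simp: N_def sum_nonneg_eq_0_iff)
      then show ?thesis by (simp add: z_def)
    qed
    ultimately show ?thesis by (auto simp: z_def)
  next
    case False
    then have "N > 0" "cmod z > 0"
      by (auto simp: N_def sum_nonneg less_le)
    \<comment> \<open>This \<open>w\<close> rotates \<open>z\<close> onto its modulus, so that
      \<open>(1 - w) * z\<close> becomes \<open>z - cmod z\<close>; when its real part is
      nonnegative, \<open>z\<close> must be real and nonnegative.\<close>
    define w where "w = cnj z / of_real (cmod z)"
    have ww: "w * cnj w = 1" and wz: "w * z = of_real (cmod z)"
      using \<open>cmod z > 0\<close> by (auto simp: w_def complex_norm_square[symmetric] power2_eq_square mult.commute)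
    define c where "c = (1 - w) / of_real N"
    have "c + cnj c = c * cnj c * of_real N"
      using \<open>N > 0\<close> ww by (simp add: c_def field_simps)
    then have "0 \<le> Re (c * z)" by (rule vary)
    moreover have "c * z = (z - of_real (cmod z)) / of_real N"
      using wz by (simp add: c_def algebra_simps)
    ultimately have "cmod z \<le> Re z"
      using \<open>N > 0\<close> by (simp add: zero_le_divide_iff)
    then have "Re z = cmod z" using complex_Re_le_cmod[of z] by linarith
    then have "Im z = 0" by (metis cmod_power2 add_cancel_left_right power2_eq_iff zero_eq_power2)
    then have "0 \<le> z" using \<open>Re z = cmod z\<close> by (simp add: less_eq_complex_def)
    then show ?thesis by (simp add: z_def)
  qed
qed

text \<open>A coordinate \<open>j \<ge> m\<close> enters the form only linearly, never through a
  conjugate. With a one in position \<open>i\<close> and \<open>a\<close> in position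
  \<open>j\<close>, the form is affine in \<open>a\<close>, and a nonconstant affine function of a
  complex variable cannot stay nonnegative.\<close>

lemma nonneg_form_imp_right_zero:
  assumes X: "\<And>v :: nat \<Rightarrow> complex. 0 \<le> (\<Sum>i<m. \<Sum>k<n. X $$ (i, k) * v k * cnj (v i))"
    and ij: "i < m" "m \<le> j" "j < n"
  shows "X $$ (i, j) = (0 :: complex)"
proof (rule ccontr)
  assume "X $$ (i, j) \<noteq> 0"
  then have pos: "(cmod (X $$ (i, j)))\<^sup>2 > 0" by simp
  have le: "0 \<le> X $$ (i, i) + X $$ (i, j) * a" for a
  proof -
    let ?v = "\<lambda>k. if k = i then 1 else if k = j then a else 0"
    have "(\<Sum>i'<m. \<Sum>k<n. X $$ (i', k) * ?v k * cnj (?v i')) =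
        (\<Sum>i'<m. if i' = i then \<Sum>k<n. X $$ (i', k) * ?v k else 0)"
      \<comment> \<open>Since \<open>j \<ge> m\<close>, row \<open>i\<close> is the only one below
        \<open>m\<close> where the test vector is nonzero.\<close>
      using ij by (intro sum.cong refl) auto
    also have "\<dots> = (\<Sum>k<n. X $$ (i, k) * ?v k)" using ij by simp
    also have "\<dots> = (\<Sum>k<n. (if k = i then X $$ (i, k) else 0) + (if k = j then X $$ (i, k) * a else 0))"
      using ij by (intro sum.cong refl) auto
    also have "\<dots> = X $$ (i, i) + X $$ (i, j) * a" using ij by (simp add: sum.distrib)
    finally show ?thesis using X[of ?v] by simp
  qed
  \<comment> \<open>With this \<open>r\<close> the affine function takes a value with real part
    \<open>-1\<close>.\<close>
  define r where "r = (Re (X $$ (i, i)) + 1) / (cmod (X $$ (i, j)))\<^sup>2"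
  have "X $$ (i, j) * (- of_real r * cnj (X $$ (i, j))) = - of_real (r * (cmod (X $$ (i, j)))\<^sup>2)"
    by (simp add: complex_norm_square algebra_simps del: of_real_power)
  also have "r * (cmod (X $$ (i, j)))\<^sup>2 = Re (X $$ (i, i)) + 1"
    using pos by (simp add: r_def)
  finally show False
    using le[of "- of_real r * cnj (X $$ (i, j))"] by (simp add: less_eq_complex_def)
qed

section \<open>Polar decomposition of rectangular matrices\<close>

lemma append_cols_zero_index:
  assumes "A \<in> carrier_mat m m" "i < m" "j < m + p"
  shows "(A @\<^sub>c 0\<^sub>m m p) $$ (i, j) = (if j < m then A $$ (i, j) else 0)"
  using assms by (auto simp: append_cols_def append_rows_def)

lemma append_cols_carrier:
  assumes "A \<in> carrier_mat m n" "B \<in> carrier_mat m p"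
  shows "A @\<^sub>c B \<in> carrier_mat m (n + p)"
  using assms by (auto simp: append_cols_def append_rows_def)

lemma mat_adjoint_append_cols_zero:
  fixes A :: "complex mat"
  assumes "A \<in> carrier_mat m m"
  shows "mat_adjoint (A @\<^sub>c 0\<^sub>m m p) = mat_adjoint A @\<^sub>r 0\<^sub>m p m"
  using assms by (intro eq_matI) (auto simp: append_cols_def append_rows_def)

lemma quadratic_form_eq_sum:
  fixes A :: "complex mat"
  assumes "A \<in> carrier_mat m m" "v \<in> carrier_vec m"
  shows "(A *\<^sub>v v) \<bullet>c v = (\<Sum>i<m. \<Sum>k<m. A $$ (i, k) * v $ k * cnj (v $ i))"
  using assms
  by (auto simp: scalar_prod_def lessThan_atLeast0 sum_distrib_right intro!: sum.cong)

text \<open>The form of the adjoint is the complex conjugate of the form of \<open>A\<close>, and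
  conjugation fixes nonnegative reals. This carries positivity from the superdiagonal to the
  subdiagonal statement.\<close>

lemma positive_mat_adjoint:
  assumes "positive_mat A"
  shows "positive_mat (mat_adjoint A)"
proof -
  define m where "m = dim_row A"
  have A: "A \<in> carrier_mat m m" and A': "mat_adjoint A \<in> carrier_mat m m"
    using assms by (auto simp: positive_mat_def m_def)
  have "0 \<le> (mat_adjoint A *\<^sub>v v) \<bullet>c v" if v: "v \<in> carrier_vec m" for v
  proof -
    have "(mat_adjoint A *\<^sub>v v) \<bullet>c v = (\<Sum>i<m. \<Sum>k<m. cnj (A $$ (k, i)) * v $ k * cnj (v $ i))"
      using A by (subst quadratic_form_eq_sum[OF A' v]) (auto intro!: sum.cong)
    also have "\<dots> = (\<Sum>k<m. \<Sum>i<m. cnj (A $$ (k, i)) * v $ k * cnj (v $ i))"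
      by (rule sum.swap)
    also have "\<dots> = cnj ((A *\<^sub>v v) \<bullet>c v)"
      by (subst quadratic_form_eq_sum[OF A v]) (simp add: mult_ac)
    finally show ?thesis using assms A v by (auto simp: positive_mat_def less_eq_complex_def)
  qed
  then show ?thesis using A by (auto simp: positive_mat_def)
qed

text \<open>Replacing \<open>B\<close> by \<open>X = B * U\<close> moves the maximizer to the
  identity, because \<open>U * V\<close> is unitary whenever \<open>V\<close> is. Nonnegativity of
  the resulting form then gives both properties at once: the columns of \<open>X\<close> from
  \<open>m\<close> on vanish, and its left square part is positive.\<close>

lemma exists_unitary_right_polar:
  assumes B: "B \<in> carrier_mat m n" and "m \<le> n"
  obtains U P where "U \<in> unitary_mats n" "P \<in> carrier_mat m m" "positive_mat P"
    "B * U = P @\<^sub>c 0\<^sub>m m (n - m)"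
proof -
  obtain U where U: "U \<in> unitary_mats n"
    and maxU: "\<And>V. V \<in> unitary_mats n \<Longrightarrow>
      (\<Sum>i<m. Re ((B * V) $$ (i, i))) \<le> (\<Sum>i<m. Re ((B * U) $$ (i, i)))"
    using exists_unitary_maximizing_trace[OF assms] by blast
  have Uc: "U \<in> carrier_mat n n" using U by (rule unitary_mats_carrier)
  define X where "X = B * U"
  have X: "X \<in> carrier_mat m n" using B Uc by (simp add: X_def)
  have "(\<Sum>i<m. Re ((X * V) $$ (i, i))) \<le> (\<Sum>i<m. Re (X $$ (i, i)))"
    if V: "V \<in> unitary_mats n" for V
    using maxU[OF mult_in_unitary_mats[OF U V]]
      assoc_mult_mat[OF B Uc unitary_mats_carrier[OF V]] by (simp add: X_def)
  then have form: "0 \<le> (\<Sum>i<m. \<Sum>k<n. X $$ (i, k) * v k * cnj (v i))" for v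
    by (rule nonneg_form_if_trace_maximal[OF X \<open>m \<le> n\<close>])
  have zero: "X $$ (i, j) = 0" if "i < m" "m \<le> j" "j < n" for i j
    using form that by (rule nonneg_form_imp_right_zero)
  define P where "P = mat m m (($$) X)"
  have P: "P \<in> carrier_mat m m" by (simp add: P_def)
  have "0 \<le> (P *\<^sub>v v) \<bullet>c v" if v: "v \<in> carrier_vec m" for v
  proof -
    \<comment> \<open>The form is applied to the function \<open>($) v\<close>, whose values at
      \<open>k \<ge> m\<close> lie beyond the dimension of \<open>v\<close>; they only meet zero
      columns of \<open>X\<close>.\<close>
    have "(\<Sum>k<n. X $$ (i, k) * v $ k * cnj (v $ i)) = (\<Sum>k<m. P $$ (i, k) * v $ k * cnj (v $ i))"
      if "i < m" for i
      using that zero \<open>m \<le> n\<close> by (intro sum.mono_neutral_cong_right) (auto simp: P_def)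
    then have "(P *\<^sub>v v) \<bullet>c v = (\<Sum>i<m. \<Sum>k<n. X $$ (i, k) * v $ k * cnj (v $ i))"
      by (simp add: quadratic_form_eq_sum[OF P v])
    then show ?thesis using form by simp
  qed
  then have "positive_mat P" using P by (auto simp: positive_mat_def)
  moreover have "B * U = P @\<^sub>c 0\<^sub>m m (n - m)"
  proof (rule eq_matI)
    have c: "P @\<^sub>c 0\<^sub>m m (n - m) \<in> carrier_mat m n"
      using append_cols_carrier[OF P, of "0\<^sub>m m (n - m)" "n - m"] \<open>m \<le> n\<close> by simp
    then show "dim_row (B * U) = dim_row (P @\<^sub>c 0\<^sub>m m (n - m))"
      "dim_col (B * U) = dim_col (P @\<^sub>c 0\<^sub>m m (n - m))"
      using B Uc by auto
    fix i j assume "i < dim_row (P @\<^sub>c 0\<^sub>m m (n - m))" "j < dim_col (P @\<^sub>c 0\<^sub>m m (n - m))"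
    then have "i < m" "j < n" using c by auto
    then show "(B * U) $$ (i, j) = (P @\<^sub>c 0\<^sub>m m (n - m)) $$ (i, j)"
      using append_cols_zero_index[OF P, of i j "n - m"] zero \<open>m \<le> n\<close>
      by (auto simp: X_def[symmetric] P_def)
  qed
  ultimately show ?thesis using U P that by blast
qed

text \<open>\<open>W k\<close> is already fixed when \<open>W (k + 1)\<close> is chosen, so
  dependent choice applies; monotone sizes make each matrix at least as wide as high.
  \<open>D\<close> is left general to serve both for the superdiagonal blocks and for the adjoints
  of the subdiagonal ones.\<close>

lemma exists_unitary_chain:
  fixes n :: "nat \<Rightarrow> nat"
  assumes D: "\<And>k. D k \<in> carrier_mat (n k) (n (k + 1))" and "mono n"
  shows "\<exists>W. \<forall>k. W k \<in> unitary_mats (n k) \<and>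
    (\<exists>P \<in> carrier_mat (n k) (n k). positive_mat P \<and>
      mat_adjoint (W k) * D k * W (k + 1) = P @\<^sub>c 0\<^sub>m (n k) (n (k + 1) - n k))"
proof -
  have "\<exists>W. \<forall>k. W k \<in> unitary_mats (n k) \<and>
    (\<exists>P \<in> carrier_mat (n k) (n k). positive_mat P \<and>
      mat_adjoint (W k) * D k * W (Suc k) = P @\<^sub>c 0\<^sub>m (n k) (n (k + 1) - n k))"
  proof (rule dependent_nat_choice)
    \<comment> \<open>The first unitary is unconstrained: only its successor has to adapt to
      it.\<close>
    show "\<exists>U. U \<in> unitary_mats (n 0)" using one_in_unitary_mats by blast
  next
    fix U k assume "U \<in> unitary_mats (n k)"
    then have "mat_adjoint U * D k \<in> carrier_mat (n k) (n (k + 1))"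
      by (intro mult_carrier_mat[OF mat_adjoint_carrier[OF unitary_mats_carrier] D])
    moreover have "n k \<le> n (k + 1)" using \<open>mono n\<close> by (simp add: monoD)
    ultimately obtain V P where "V \<in> unitary_mats (n (k + 1))" "P \<in> carrier_mat (n k) (n k)"
      "positive_mat P" "mat_adjoint U * D k * V = P @\<^sub>c 0\<^sub>m (n k) (n (k + 1) - n k)"
      by (rule exists_unitary_right_polar)
    then show "\<exists>V. V \<in> unitary_mats (n (Suc k)) \<and>
      (\<exists>P \<in> carrier_mat (n k) (n k). positive_mat P \<and>
        mat_adjoint U * D k * V = P @\<^sub>c 0\<^sub>m (n k) (n (k + 1) - n k))"
      by auto
  qed
  then show ?thesis by simp
qed

section \<open>Rotating the blocks of an orthonormal basis\<close>

lemma cinner_sum_left: "cinner (\<Sum>i\<in>A. f i) y = (\<Sum>i\<in>A. cinner (f i) y)"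
proof (induction A rule: infinite_finite_induct)
  case empty
  show ?case using cinner_scaleC_left[of 0 0 y] by simp
next
  case (infinite A)
  then show ?case using cinner_scaleC_left[of 0 0 y] by simp
qed (simp_all add: cinner_add_left)

lemma cinner_sum_right: "cinner x (\<Sum>i\<in>A. f i) = (\<Sum>i\<in>A. cinner x (f i))"
  by (subst (1 2) cinner_commute) (simp add: cinner_sum_left)

lemma cinner_scaleC_right: "cinner x (a *\<^sub>C y) = cnj a * cinner x y"
  by (subst (1 2) cinner_commute) (simp add: cinner_scaleC_left)

text \<open>The matrix of the identity operator collects the inner products of the basis vectors.
  Orthonormality of a rotated basis thus becomes the case \<open>T = id\<close> of the formula for
  rotated blocks.\<close>

lemma bounded_clinear_id: "bounded_clinear (\<lambda>x. x)"
  by (simp add: bounded_clinear_def bounded_linear_ident)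

section \<open>Locating an index in its block\<close>

lemma block_start_Suc: "block_start n (Suc k) = block_start n k + n k"
  by (simp add: block_start_def)

lemma block_start_mono: "k \<le> l \<Longrightarrow> block_start n k \<le> block_start n l"
  unfolding block_start_def by (intro sum_mono2) auto

text \<open>Testing the upper end suffices: by minimality, the preceding block has ended at or
  before \<open>p\<close>.\<close>

definition block_of :: "(nat \<Rightarrow> nat) \<Rightarrow> nat \<Rightarrow> nat" where
  "block_of n p = (LEAST k. p < block_start n (Suc k))"

lemma block_of_eq:
  assumes "i < n k"
  shows "block_of n (block_start n k + i) = k"
  unfolding block_of_def
proof (rule Least_equality)
  show "block_start n k + i < block_start n (Suc k)"
    using assms by (simp add: block_start_Suc)
  fix l assume l: "block_start n k + i < block_start n (Suc l)"
  show "k \<le> l"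
  proof (rule ccontr)
    assume "\<not> k \<le> l"
    then have "block_start n (Suc l) \<le> block_start n k" by (intro block_start_mono) simp
    then show False using l by simp
  qed
qed

lemma block_index_eq_iff:
  assumes "i < n k" "j < n l"
  shows "block_start n k + i = block_start n l + j \<longleftrightarrow> k = l \<and> i = j"
  using block_of_eq[of i n k] block_of_eq[of j n l] assms by auto

lemma block_index_cases:
  assumes "\<And>k. 0 < n k"
  obtains k i where "i < n k" "p = block_start n k + i"
proof -
  have "\<exists>k i. i < n k \<and> p = block_start n k + i"
  proof (induction p)
    case 0
    then show ?case using assms by (intro exI[of _ 0]) (simp add: block_start_def)
  next
    case (Suc p)
    then obtain k i where ki: "i < n k" "p = block_start n k + i" by blast
    show ?case
    proof (cases "Suc i < n k")
      case True
      then show ?thesis using ki by (intro exI[of _ k] exI[of _ "Suc i"]) simp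
    next
      case False
      \<comment> \<open>Here \<open>p\<close> is the last index of block \<open>k\<close>; the next
        block is nonempty, so \<open>Suc p\<close> is its first index.\<close>
      then have "Suc p = block_start n (Suc k) + 0" using ki by (simp add: block_start_Suc)
      then show ?thesis using assms by blast
    qed
  qed
  then show ?thesis using that by blast
qed

lemma block_index:
  "i < n k \<Longrightarrow> j < n l \<Longrightarrow> block n M k l $$ (i, j) = M (block_start n k + i) (block_start n l + j)"
  by (simp add: block_def)

lemma block_carrier: "block n M k l \<in> carrier_mat (n k) (n l)"
  by (simp add: block_def)

text \<open>Used in both directions: orthonormality of the old basis is read into blocks, the blocks
  are rotated, and orthonormality of the new basis is read off.\<close>

lemma identity_iff_blocks:
  assumes "\<And>k. 0 < n k"
  shows "(\<forall>p q. M p q = (if p = q then 1 else 0)) \<longleftrightarrow>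
    (\<forall>k l. block n M k l = (if k = l then 1\<^sub>m (n k) else 0\<^sub>m (n k) (n l)))"
proof
  assume *: "\<forall>p q. M p q = (if p = q then 1 else 0)"
  show "\<forall>k l. block n M k l = (if k = l then 1\<^sub>m (n k) else 0\<^sub>m (n k) (n l))"
    by (intro allI eq_matI) (auto simp: block_def * block_index_eq_iff)
next
  assume *: "\<forall>k l. block n M k l = (if k = l then 1\<^sub>m (n k) else 0\<^sub>m (n k) (n l))"
  show "\<forall>p q. M p q = (if p = q then 1 else 0)"
  proof (intro allI)
    fix p q
    obtain k i where p: "i < n k" "p = block_start n k + i" by (rule block_index_cases[of n, OF assms])
    obtain l j where q: "j < n l" "q = block_start n l + j" by (rule block_index_cases[of n, OF assms])
    have "M p q = block n M k l $$ (i, j)" using p q by (simp add: block_index)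
    also have "\<dots> = (if p = q then 1 else 0)"
      using p q * by (auto simp: block_index_eq_iff)
    finally show "M p q = (if p = q then 1 else 0)" .
  qed
qed

section \<open>The rotated basis and its matrix\<close>

definition block_rotate ::
  "(nat \<Rightarrow> nat) \<Rightarrow> (nat \<Rightarrow> complex mat) \<Rightarrow> (nat \<Rightarrow> 'a::chilbert_space) \<Rightarrow> nat \<Rightarrow> 'a" where
  "block_rotate n W e p = (let k = block_of n p in
     \<Sum>j<n k. W k $$ (j, p - block_start n k) *\<^sub>C e (block_start n k + j))"

lemma block_rotate_eq:
  "i < n k \<Longrightarrow> block_rotate n W e (block_start n k + i) =
    (\<Sum>j<n k. W k $$ (j, i) *\<^sub>C e (block_start n k + j))"
  by (simp add: block_rotate_def block_of_eq)

text \<open>Column \<open>i\<close> of \<open>W k\<close> holds the old coordinates of a new vector.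
  As \<open>matrix_of\<close> puts \<open>T (e j)\<close> into the linear argument of
  \<open>cinner\<close> and \<open>e i\<close> into the conjugate-linear one, the factor
  \<open>W l\<close> appears on the right and the adjoint of \<open>W k\<close> on the left.\<close>

lemma block_matrix_of_block_rotate:
  assumes T: "bounded_clinear T" and W: "\<And>k. W k \<in> carrier_mat (n k) (n k)"
  shows "block n (matrix_of T (block_rotate n W e)) k l =
    mat_adjoint (W k) * block n (matrix_of T e) k l * W l"
proof (rule eq_matI)
  let ?M = "matrix_of T e"
  have Wa: "mat_adjoint (W k) \<in> carrier_mat (n k) (n k)" using W by simp
  have Wb: "mat_adjoint (W k) * block n ?M k l \<in> carrier_mat (n k) (n l)"
    using Wa block_carrier by (rule mult_carrier_mat)
  show "dim_row (block n (matrix_of T (block_rotate n W e)) k l) =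
      dim_row (mat_adjoint (W k) * block n ?M k l * W l)"
    "dim_col (block n (matrix_of T (block_rotate n W e)) k l) =
      dim_col (mat_adjoint (W k) * block n ?M k l * W l)"
    using W[of k] W[of l] by (auto simp: block_def)
  fix i j assume "i < dim_row (mat_adjoint (W k) * block n ?M k l * W l)"
    "j < dim_col (mat_adjoint (W k) * block n ?M k l * W l)"
  then have ij: "i < n k" "j < n l" using W[of k] W[of l] by auto
  have T_sum: "T (\<Sum>q<n l. c q *\<^sub>C x q) = (\<Sum>q<n l. c q *\<^sub>C T (x q))" for c x
    using T by (simp add: bounded_clinear_def linear_sum bounded_linear.linear)
  have "block n (matrix_of T (block_rotate n W e)) k l $$ (i, j) =
      (\<Sum>p<n k. \<Sum>q<n l. cnj (W k $$ (p, i)) * (W l $$ (q, j) *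
        ?M (block_start n k + p) (block_start n l + q)))"
    using ij by (simp add: block_index matrix_of_def block_rotate_eq T_sum cinner_sum_left
        cinner_sum_right cinner_scaleC_left cinner_scaleC_right sum_distrib_left)
  also have "\<dots> = (\<Sum>q<n l. \<Sum>p<n k. W l $$ (q, j) * (cnj (W k $$ (p, i)) *
        ?M (block_start n k + p) (block_start n l + q)))"
    by (subst sum.swap) (simp add: mult_ac)
  also have "\<dots> = (\<Sum>q<n l. (mat_adjoint (W k) * block n ?M k l) $$ (i, q) * W l $$ (q, j))"
  proof (intro sum.cong refl)
    fix q assume "q \<in> {..<n l}"
    then have q: "q < n l" by simp
    have "(mat_adjoint (W k) * block n ?M k l) $$ (i, q) =
        (\<Sum>p<n k. cnj (W k $$ (p, i)) * ?M (block_start n k + p) (block_start n l + q))"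
      using ij q W[of k] by (subst mult_mat_index[OF Wa block_carrier[of n ?M k l]]) (auto simp: block_index)
    then show "(\<Sum>p<n k. W l $$ (q, j) * (cnj (W k $$ (p, i)) *
          ?M (block_start n k + p) (block_start n l + q))) =
        (mat_adjoint (W k) * block n ?M k l) $$ (i, q) * W l $$ (q, j)"
      by (simp add: sum_distrib_left mult.commute)
  qed
  also have "\<dots> = (mat_adjoint (W k) * block n ?M k l * W l) $$ (i, j)"
    using mult_mat_index[OF Wb W ij] by simp
  finally show "block n (matrix_of T (block_rotate n W e)) k l $$ (i, j) =
    (mat_adjoint (W k) * block n ?M k l * W l) $$ (i, j)" .
qed

lemma mat_adjoint_mult_zero_mult:
  assumes "\<And>k. W k \<in> carrier_mat (n k) (n k)"
  shows "mat_adjoint (W k) * 0\<^sub>m (n k) (n l) * W l = 0\<^sub>m (n k) (n l)"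
proof -
  have "mat_adjoint (W k) * 0\<^sub>m (n k) (n l) = 0\<^sub>m (n k) (n l)"
    using assms by (intro right_mult_zero_mat mat_adjoint_carrier)
  then show ?thesis using left_mult_zero_mat[OF assms] by simp
qed

text \<open>Orthonormality follows from the blocks of the identity operator. For density it is
  enough that every old vector is a finite combination of new vectors of its own block.\<close>

lemma orthonormal_basis_block_rotate:
  assumes e: "orthonormal_basis e" and n: "\<And>k. 0 < n k"
    and W: "\<And>k. W k \<in> unitary_mats (n k)"
  shows "orthonormal_basis (block_rotate n W e)"
proof -
  let ?f = "block_rotate n W e"
  have Wc: "W k \<in> carrier_mat (n k) (n k)" for k using W by (rule unitary_mats_carrier)
  have "matrix_of (\<lambda>x. x) e p q = (if p = q then 1 else 0)" for p q
    using e by (auto simp: orthonormal_basis_def matrix_of_def)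
  then have e_blocks: "block n (matrix_of (\<lambda>x. x) e) k l =
      (if k = l then 1\<^sub>m (n k) else 0\<^sub>m (n k) (n l))" for k l
    using identity_iff_blocks[of n "matrix_of (\<lambda>x. x) e", OF n] by blast
  have "block n (matrix_of (\<lambda>x. x) ?f) k l = (if k = l then 1\<^sub>m (n k) else 0\<^sub>m (n k) (n l))" for k l
  proof -
    have "mat_adjoint (W k) * 1\<^sub>m (n k) = mat_adjoint (W k)"
      using right_mult_one_mat[OF mat_adjoint_carrier[OF Wc]] .
    moreover have "mat_adjoint (W k) * W k = 1\<^sub>m (n k)" using W by (simp add: unitary_mats_def)
    ultimately show ?thesis
      by (cases "k = l") (simp_all add: block_matrix_of_block_rotate[OF bounded_clinear_id Wc] e_blocks
          mat_adjoint_mult_zero_mult[of W n, OF Wc])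
  qed
  then have "matrix_of (\<lambda>x. x) ?f p q = (if p = q then 1 else 0)" for p q
    using identity_iff_blocks[of n "matrix_of (\<lambda>x. x) ?f", OF n] by blast
  then have orth: "cinner (?f p) (?f q) = (if p = q then 1 else 0)" for p q
    by (simp add: matrix_of_def)
  have "e p \<in> complex_vector.span (range ?f)" for p
  proof -
    obtain k q where p: "q < n k" "p = block_start n k + q" by (rule block_index_cases[of n, OF n])
    \<comment> \<open>Orthonormality of the rows of \<open>W k\<close>: combining the new vectors of
      the block with the conjugates of row \<open>q\<close> leaves only the old vector number
      \<open>q\<close>.\<close>
    have WW: "(\<Sum>i<n k. cnj (W k $$ (q, i)) * W k $$ (j, i)) = (if j = q then 1 else 0)"
      if j: "j < n k" for j
    proof -
      have "(W k * mat_adjoint (W k)) $$ (j, q) = (\<Sum>i<n k. cnj (W k $$ (q, i)) * W k $$ (j, i))"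
        using j p Wc[of k] by (subst mult_mat_index[of _ "n k" "n k" _ "n k"])
          (auto simp: mult.commute)
      then show ?thesis using unitary_mats_mult_adjoint[OF W[of k]] j p by simp
    qed
    have "(\<Sum>i<n k. cnj (W k $$ (q, i)) *\<^sub>C ?f (block_start n k + i)) =
        (\<Sum>i<n k. \<Sum>j<n k. (cnj (W k $$ (q, i)) * W k $$ (j, i)) *\<^sub>C e (block_start n k + j))"
      by (simp add: block_rotate_eq complex_vector.scale_sum_right)
    also have "\<dots> = (\<Sum>j<n k. (\<Sum>i<n k. cnj (W k $$ (q, i)) * W k $$ (j, i)) *\<^sub>C e (block_start n k + j))"
      by (subst sum.swap) (simp add: complex_vector.scale_sum_left)
    also have "\<dots> = (\<Sum>j<n k. if j = q then e (block_start n k + j) else 0)"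
      by (intro sum.cong refl) (simp add: WW)
    also have "\<dots> = e p" using p by simp
    finally show ?thesis
      by (metis (no_types, lifting) complex_vector.span_sum complex_vector.span_scale
          complex_vector.span_base rangeI)
  qed
  then have "complex_vector.span (range e) \<subseteq> complex_vector.span (range ?f)"
    by (intro complex_vector.span_minimal) auto
  then have "closure (complex_vector.span (range e)) \<subseteq> closure (complex_vector.span (range ?f))"
    by (rule closure_mono)
  then show ?thesis using e orth by (auto simp: orthonormal_basis_def)
qed

text \<open>Rotation multiplies each block separately from both sides and never mixes blocks, so
  zero blocks stay zero.\<close>

lemma block_tridiagonal_block_rotate:
  assumes "bounded_clinear T" "\<And>k. W k \<in> carrier_mat (n k) (n k)"
    and "block_tridiagonal n (matrix_of T e)"
  shows "block_tridiagonal n (matrix_of T (block_rotate n W e))"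
  using assms(3) by (simp add: block_tridiagonal_def block_matrix_of_block_rotate[OF assms(1,2)]
      mat_adjoint_mult_zero_mult[of W n, OF assms(2)])

theorem theorem2p7:
  fixes T :: "'a::chilbert_space \<Rightarrow> 'a"
    and e :: "nat \<Rightarrow> 'a"
    and n :: "nat \<Rightarrow> nat"
  assumes "bounded_clinear T"
    and "orthonormal_basis e"
    and "block_tridiagonal n (matrix_of T e)"
    and "mono n"
  shows "(\<exists>f. orthonormal_basis f \<and> block_tridiagonal n (matrix_of T f) \<and>
           (\<forall>k. \<exists>A' \<in> carrier_mat (n k) (n k). positive_mat A' \<and>
              block n (matrix_of T f) k (k + 1) = A' @\<^sub>c 0\<^sub>m (n k) (n (k + 1) - n k))) \<and>
         (\<exists>g. orthonormal_basis g \<and> block_tridiagonal n (matrix_of T g) \<and>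
           (\<forall>k. \<exists>B' \<in> carrier_mat (n k) (n k). positive_mat B' \<and>
              block n (matrix_of T g) (k + 1) k = B' @\<^sub>r 0\<^sub>m (n (k + 1) - n k) (n k)))"
proof -
  let ?M = "matrix_of T e"
  have n: "0 < n k" for k using assms(3) by (simp add: block_tridiagonal_def)
  \<comment> \<open>Stated for arbitrary unitaries, since the two normal forms use two different
    families, \<open>U\<close> and \<open>V\<close>.\<close>
  have basis: "orthonormal_basis (block_rotate n W e)"
    and tri: "block_tridiagonal n (matrix_of T (block_rotate n W e))"
    and blocks: "\<And>k l. block n (matrix_of T (block_rotate n W e)) k l =
      mat_adjoint (W k) * block n ?M k l * W l"
    if W: "\<And>k. W k \<in> unitary_mats (n k)" for W
  proof -
    have Wc: "W k \<in> carrier_mat (n k) (n k)" for k using W by (rule unitary_mats_carrier)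
    show "orthonormal_basis (block_rotate n W e)"
      by (rule orthonormal_basis_block_rotate[OF assms(2) n W])
    show "block_tridiagonal n (matrix_of T (block_rotate n W e))"
      by (rule block_tridiagonal_block_rotate[OF assms(1) Wc assms(3)])
    show "block n (matrix_of T (block_rotate n W e)) k l =
      mat_adjoint (W k) * block n ?M k l * W l" for k l
      by (rule block_matrix_of_block_rotate[OF assms(1) Wc])
  qed
  have D: "block n ?M k l \<in> carrier_mat (n k) (n l)" for k l by (rule block_carrier)
  obtain U where U: "\<And>k. U k \<in> unitary_mats (n k)"
    "\<And>k. \<exists>P \<in> carrier_mat (n k) (n k). positive_mat P \<and>
      mat_adjoint (U k) * block n ?M k (k + 1) * U (k + 1) = P @\<^sub>c 0\<^sub>m (n k) (n (k + 1) - n k)"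
    using exists_unitary_chain[of "\<lambda>k. block n ?M k (k + 1)" n, OF D assms(4)] by blast
  have "\<forall>k. \<exists>A' \<in> carrier_mat (n k) (n k). positive_mat A' \<and>
      block n (matrix_of T (block_rotate n U e)) k (k + 1) = A' @\<^sub>c 0\<^sub>m (n k) (n (k + 1) - n k)"
    unfolding blocks[OF U(1)] using U(2) by (rule allI)
  \<comment> \<open>The adjoint of a subdiagonal block has the shape of a superdiagonal block, so
    the same chain construction applies to it.\<close>
  moreover obtain V where V: "\<And>k. V k \<in> unitary_mats (n k)"
    "\<And>k. \<exists>P \<in> carrier_mat (n k) (n k). positive_mat P \<and>
      mat_adjoint (V k) * mat_adjoint (block n ?M (k + 1) k) * V (k + 1) =
        P @\<^sub>c 0\<^sub>m (n k) (n (k + 1) - n k)"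
    using exists_unitary_chain[of "\<lambda>k. mat_adjoint (block n ?M (k + 1) k)" n,
          OF mat_adjoint_carrier[OF D] assms(4)] by blast
  moreover have "\<exists>B' \<in> carrier_mat (n k) (n k). positive_mat B' \<and>
      block n (matrix_of T (block_rotate n V e)) (k + 1) k = B' @\<^sub>r 0\<^sub>m (n (k + 1) - n k) (n k)" for k
  proof -
    obtain P where P: "P \<in> carrier_mat (n k) (n k)" "positive_mat P"
      and eq: "mat_adjoint (V k) * mat_adjoint (block n ?M (k + 1) k) * V (k + 1) =
        P @\<^sub>c 0\<^sub>m (n k) (n (k + 1) - n k)"
      using V(2) by blast
    have Vc: "V k \<in> carrier_mat (n k) (n k)" "V (k + 1) \<in> carrier_mat (n (k + 1)) (n (k + 1))"
      using V(1) by (blast intro: unitary_mats_carrier)+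
    have B: "block n ?M (k + 1) k \<in> carrier_mat (n (k + 1)) (n k)" by (rule block_carrier)
    \<comment> \<open>The rotated subdiagonal block is rewritten as the adjoint of the product that
      the chain brings into the form \<open>(P | 0)\<close>; taking the adjoint turns the zero
      columns into zero rows below the adjoint of \<open>P\<close>.\<close>
    have "block n (matrix_of T (block_rotate n V e)) (k + 1) k =
        mat_adjoint (V (k + 1)) * (block n ?M (k + 1) k * V k)"
      using assoc_mult_mat[OF mat_adjoint_carrier[OF Vc(2)] B Vc(1)] by (simp only: blocks[OF V(1)])
    also have "\<dots> = mat_adjoint (mat_adjoint (block n ?M (k + 1) k * V k) * V (k + 1))"
      using mat_adjoint_mult[OF mat_adjoint_carrier[OF mult_carrier_mat[OF B Vc(1)]] Vc(2)] by simp
    also have "mat_adjoint (block n ?M (k + 1) k * V k) * V (k + 1) =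
        P @\<^sub>c 0\<^sub>m (n k) (n (k + 1) - n k)"
      using eq by (simp only: mat_adjoint_mult[OF B Vc(1)])
    also have "mat_adjoint \<dots> = mat_adjoint P @\<^sub>r 0\<^sub>m (n (k + 1) - n k) (n k)"
      by (rule mat_adjoint_append_cols_zero[OF P(1)])
    finally show ?thesis using P mat_adjoint_carrier positive_mat_adjoint by blast
  qed
  ultimately show ?thesis using basis[OF U(1)] tri[OF U(1)] basis[OF V(1)] tri[OF V(1)] by blast
qed
end
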